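(* Let $E$ be a finite set with $|E|\ge2$, let $K\subseteq\mathbb R_+^E$ be an upper-box-integer rational polyhedral cone, let $P=K\cap[0,1]^E$, and assume that $P$ has the integer decomposition property. Let $c\in\mathbb Q^E$, let $\alpha=\max\{c^\top x:x\in P\}$, and assume $\alpha>0$. Then for every $\ell\ge2$ and every $J\subseteq E$: $J\in\mathcal B_\ell$ if and only if there exists an optimal solution $u$ of the dual problem $$\min\{\mathbf 1^\top u:\ u\ge0,\ u-c\in K^*\}$$ with $\operatorname{supp}(u)\subseteq J$. Consequently, $\mathcal B_2=\mathcal B_3=\cdots=\mathcal B_\infty$ and $\mathcal D_2=\mathcal D_3=\cdots=\mathcal D_\infty$, and $\mathcal D_2$ is the family of inclusion-minimal supports of optimal solutions $u$ of this dual problem (optimal upper-bound multiplier vectors).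
   Context: For $y\in\mathbb R_+^E$, $\operatorname{supp}(y)=\{e\in E:y_e>0\}$. $K^*=\{s\in\mathbb R^E:s^\top x\ge0\ \forall x\in K\}$. $K$ is upper-box-integer if $K\cap[0,b]$ is an integral polytope (the convex hull of its integer points) for every integral vector $b\ge0$. $P$ has the integer decomposition property if for every integer $k\ge1$ and every integer point $x\in kP$ there exist integer points $x^1,\dots,x^k\in P$ with $x=x^1+\cdots+x^k$. For an integer $\ell\ge1$, $\mathcal B_\ell$ is the family of sets $J\subseteq E$ such that for all $z^1,\dots,z^\ell\in P$: $\left(\bigcap_{i=1}^\ell\operatorname{supp}(z^i)\right)\cap J=\emptyset$ implies $\sum_{i=1}^\ell c^\top z^i\le\alpha(\ell-1)$. $\mathcal B_\infty=\bigcap_{\ell\ge1}\mathcal B_\ell$. $\mathcal D_\ell$ (resp. $\mathcal D_\infty$) is the family of inclusion-minimal members of $\mathcal B_\ell$ (resp. $\mathcal B_\infty$). *)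

theory Defs
  imports "HOL-Analysis.Analysis"
begin

text \<open>
  The finite ground set is the index type \<open>'e\<close>, so vectors indexed by it have type \<open>real ^ 'e\<close>.
  The constants \<open>0\<close> and \<open>1\<close> of that type are the all-zeros and all-ones vectors, and
  \<^term>\<open>cbox a b\<close> is the coordinatewise box.
\<close>

definition rational_vectors :: "(real ^ 'e) set" where
  "rational_vectors = {x. \<forall>e. x $ e \<in> \<rat>}"

definition integer_points :: "(real ^ 'e) set" where
  "integer_points = {x. \<forall>e. x $ e \<in> \<int>}"

definition nonneg_orthant :: "(real ^ 'e) set" where
  "nonneg_orthant = {x. \<forall>e. 0 \<le> x $ e}"

text \<open>Only meant for nonnegative vectors, where this is the set of nonzero coordinates.\<close>

definition supp :: "real ^ 'e \<Rightarrow> 'e set" where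
  "supp y = {e. 0 < y $ e}"

definition rational_polyhedral_cone :: "(real ^ 'e) set \<Rightarrow> bool" where
  "rational_polyhedral_cone K \<longleftrightarrow>
    (\<exists>A. finite A \<and> A \<subseteq> rational_vectors \<and> K = {x. \<forall>a\<in>A. 0 \<le> a \<bullet> x})"

definition dual_cone :: "(real ^ 'e) set \<Rightarrow> (real ^ 'e) set" where
  "dual_cone K = {s. \<forall>x\<in>K. 0 \<le> s \<bullet> x}"

definition integral_polytope :: "(real ^ 'e) set \<Rightarrow> bool" where
  "integral_polytope S \<longleftrightarrow> polytope S \<and> S = convex hull (S \<inter> integer_points)"

definition upper_box_integer :: "(real ^ 'e) set \<Rightarrow> bool" where
  "upper_box_integer K \<longleftrightarrow>
    (\<forall>b \<in> integer_points \<inter> nonneg_orthant. integral_polytope (K \<inter> cbox 0 b))"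

definition integer_decomposition :: "(real ^ 'e) set \<Rightarrow> bool" where
  "integer_decomposition P \<longleftrightarrow>
    (\<forall>k::nat. 1 \<le> k \<longrightarrow>
      (\<forall>x \<in> (\<lambda>p. real k *\<^sub>R p) ` P \<inter> integer_points.
        \<exists>y :: nat \<Rightarrow> real ^ 'e.
          (\<forall>i\<in>{1..k}. y i \<in> P \<inter> integer_points) \<and> x = (\<Sum>i=1..k. y i)))"

definition unit_box_part :: "(real ^ 'e) set \<Rightarrow> (real ^ 'e) set" where
  "unit_box_part K = K \<inter> cbox 0 1"

text \<open>
  The greatest element of the set of objective values; it is meaningful when the maximum is
  attained, as it is for \<^term>\<open>P\<close> compact and nonempty.
\<close>

definition max_value :: "(real ^ 'e) set \<Rightarrow> real ^ 'e \<Rightarrow> real" where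
  "max_value P c = (GREATEST v. v \<in> (\<lambda>x. c \<bullet> x) ` P)"

definition B_fam :: "(real ^ 'e) set \<Rightarrow> real ^ 'e \<Rightarrow> nat \<Rightarrow> 'e set set" where
  "B_fam P c l = {J. \<forall>z :: nat \<Rightarrow> real ^ 'e.
      (\<forall>i\<in>{1..l}. z i \<in> P) \<longrightarrow>
      (\<Inter>i\<in>{1..l}. supp (z i)) \<inter> J = {} \<longrightarrow>
      (\<Sum>i=1..l. c \<bullet> z i) \<le> max_value P c * (real l - 1)}"

definition B_inf :: "(real ^ 'e) set \<Rightarrow> real ^ 'e \<Rightarrow> 'e set set" where
  "B_inf P c = (\<Inter>l\<in>{1..}. B_fam P c l)"

definition minimal_members :: "'e set set \<Rightarrow> 'e set set" where
  "minimal_members F = {J \<in> F. \<forall>J'\<in>F. J' \<subseteq> J \<longrightarrow> J' = J}"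

definition D_fam :: "(real ^ 'e) set \<Rightarrow> real ^ 'e \<Rightarrow> nat \<Rightarrow> 'e set set" where
  "D_fam P c l = minimal_members (B_fam P c l)"

definition D_inf :: "(real ^ 'e) set \<Rightarrow> real ^ 'e \<Rightarrow> 'e set set" where
  "D_inf P c = minimal_members (B_inf P c)"

definition dual_feasible :: "(real ^ 'e) set \<Rightarrow> real ^ 'e \<Rightarrow> (real ^ 'e) set" where
  "dual_feasible K c = {u. u \<in> nonneg_orthant \<and> u - c \<in> dual_cone K}"

definition dual_optimal :: "(real ^ 'e) set \<Rightarrow> real ^ 'e \<Rightarrow> (real ^ 'e) set" where
  "dual_optimal K c =
    {u \<in> dual_feasible K c. \<forall>v \<in> dual_feasible K c. 1 \<bullet> u \<le> 1 \<bullet> v}"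

end

theory Submission
  imports Defs
begin

text \<open>
  Write \<open>\<alpha>\<close> for the maximum of \<open>c\<close> over \<open>P\<close>. A set \<open>J\<close> contains the support of a dual optimal
  solution exactly when dropping the upper bounds outside \<open>J\<close> does not raise the maximum, that is,
  when \<open>c \<bullet> x \<le> \<alpha>\<close> for all \<open>x \<in> K\<close> with \<open>x $ e \<le> 1\<close> on \<open>J\<close>. This is linear programming duality
  (\<open>dual_feasible_supported_on\<close>), and the point of the proof is to relate the relaxed problem
  to \<open>B_fam P c l\<close>.

  If \<open>u\<close> is dual optimal with support in \<open>J\<close> and the supports of the \<open>z i\<close> have no common
  element in \<open>J\<close>, then at every coordinate in \<open>J\<close> the sum of the \<open>l\<close> vectors is at most \<open>l - 1\<close>,
  and pairing it with \<open>u\<close> bounds the total objective by \<open>(l - 1) * (1 \<bullet> u) = \<alpha> * (l - 1)\<close>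
  (\<open>B_fam_if_dual_support\<close>).

  Conversely, padding with maximisers reduces every \<open>l \<ge> 2\<close> to \<open>l = 2\<close>. Relax the upper
  bounds outside \<open>J\<close> only from 1 to 2. The resulting polytope is integral, and each of its integer
  points lies in the dilation of \<open>P\<close> by 2, hence is a sum of two integer points of \<open>P\<close>. These
  cannot both be positive at a coordinate in \<open>J\<close>, where their sum is at most 1, so membership
  in \<open>B_fam P c 2\<close> bounds the objective by \<open>\<alpha>\<close> (\<open>relaxation_to_two\<close>). A maximiser over \<open>P\<close>
  has value \<open>\<alpha>\<close> and slack in the relaxed bounds, so \<open>\<alpha>\<close> is already a local maximum of the problem
  without those bounds; by convexity it is a global one (\<open>relaxation_unbounded\<close>).
\<close>

section \<open>Linear programming duality with upper bounds on a subset\<close>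

text \<open>
  If no such \<open>u\<close> exists, then \<open>c\<close> lies outside the set of all \<open>u - s\<close> with \<open>s\<close> in the dual cone and
  \<open>u \<ge> 0\<close> supported on \<open>J\<close> with entry sum at most \<open>\<alpha>\<close>. That set is closed, being the Minkowski
  difference of a compact set and a closed one, and a hyperplane separating \<open>c\<close> from it has a
  normal vector that, after scaling, is a point of the relaxed problem with objective value
  above \<open>\<alpha>\<close>.
\<close>

lemma dual_feasible_supported_on:
  fixes K A :: "(real ^ 'e) set" and c :: "real ^ 'e"
  assumes K: "K = {x. \<forall>a\<in>A. 0 \<le> a \<bullet> x}"
    and pos: "0 < \<alpha>"
    and bound: "\<And>x. x \<in> K \<Longrightarrow> \<forall>e\<in>J. x $ e \<le> 1 \<Longrightarrow> c \<bullet> x \<le> \<alpha>"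
  shows "\<exists>u\<in>dual_feasible K c. supp u \<subseteq> J \<and> 1 \<bullet> u \<le> \<alpha>"
proof -
  define U where "U = {u :: real ^ 'e. (\<forall>e. 0 \<le> u $ e) \<and> (\<forall>e. e \<notin> J \<longrightarrow> u $ e = 0) \<and> 1 \<bullet> u \<le> \<alpha>}"
  define Q where "Q = (\<Union>u\<in>U. \<Union>s\<in>dual_cone K. {u - s})"
  have one: "1 \<bullet> u = (\<Sum>e\<in>UNIV. u $ e)" for u :: "real ^ 'e"
    by (simp add: inner_vec_def)
  have convU: "convex U"
    unfolding convex_def
  proof (intro ballI allI impI)
    fix u v :: "real ^ 'e" and s t :: real
    assume u: "u \<in> U" and v: "v \<in> U" and st: "0 \<le> s" "0 \<le> t" "s + t = 1"
    have "s * (1 \<bullet> u) + t * (1 \<bullet> v) \<le> \<alpha>"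
      using u v st by (intro convex_bound_le) (simp_all add: U_def)
    then show "s *\<^sub>R u + t *\<^sub>R v \<in> U"
      using u v st by (simp add: U_def inner_add_right)
  qed
  have "closed U"
  proof -
    have "U = (\<Inter>e. {u. 0 \<le> u $ e}) \<inter> (\<Inter>e\<in>-J. {u. u $ e = 0}) \<inter> {u. 1 \<bullet> u \<le> \<alpha>}"
      by (auto simp: U_def)
    then show ?thesis
      by (auto intro!: closed_INT closed_Int closed_Collect_le closed_Collect_eq continuous_intros)
  qed
  moreover have "bounded U"
  proof (rule bounded_subset[OF bounded_cbox])
    show "U \<subseteq> cbox 0 (\<chi> e. \<alpha>)"
    proof
      fix u assume u: "u \<in> U"
      have "u $ e \<le> 1 \<bullet> u" for e
        unfolding one using u by (intro member_le_sum) (auto simp: U_def)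
      then show "u \<in> cbox 0 (\<chi> e. \<alpha>)"
        using u by (force simp: U_def mem_box_cart intro: order_trans)
    qed
  qed
  ultimately have compU: "compact U"
    by (simp add: compact_eq_bounded_closed)
  have convD: "convex (dual_cone K)"
    unfolding convex_def dual_cone_def by (auto simp: inner_add_left)
  have closD: "closed (dual_cone K)"
  proof -
    have "dual_cone K = (\<Inter>x\<in>K. {s. 0 \<le> s \<bullet> x})"
      by (auto simp: dual_cone_def)
    then show ?thesis
      by (auto intro!: closed_INT closed_Collect_le continuous_intros)
  qed
  have closQ: "closed Q"
    unfolding Q_def by (rule compact_closed_differences[OF compU closD])
  have convQ: "convex Q"
    unfolding Q_def by (rule convex_differences[OF convU convD])
  have zeroU: "0 \<in> U" using pos by (simp add: U_def)
  have zeroD: "0 \<in> dual_cone K" by (simp add: dual_cone_def)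
  have "c \<in> Q"
  proof (rule ccontr)
    assume "c \<notin> Q"
    then obtain a' b' where sep: "a' \<bullet> c < b'" "\<And>q. q \<in> Q \<Longrightarrow> b' < a' \<bullet> q"
      using separating_hyperplane_closed_point[OF convQ closQ, of c] by blast
    define a b where "a = - a'" and "b = - b'"
    have ac: "b < c \<bullet> a" using sep(1) by (simp add: a_def b_def inner_commute)
    have aq: "a \<bullet> (u - s) < b" if "u \<in> U" "s \<in> dual_cone K" for u s
    proof -
      have "u - s \<in> Q" using that by (auto simp: Q_def)
      from sep(2)[OF this] show ?thesis by (simp add: a_def b_def)
    qed
    have b0: "0 < b" using aq[OF zeroU zeroD] by simp
    have aD: "0 \<le> a \<bullet> s" if s: "s \<in> dual_cone K" for s
    proof (rule ccontr)
      assume neg: "\<not> 0 \<le> a \<bullet> s"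
      define r where "r = b / (- (a \<bullet> s))"
      have "0 \<le> r" unfolding r_def using neg b0 by (intro divide_nonneg_pos) auto
      then have "r *\<^sub>R s \<in> dual_cone K" using s by (simp add: dual_cone_def)
      from aq[OF zeroU this] have "- (r * (a \<bullet> s)) < b" by simp
      moreover have "- (r * (a \<bullet> s)) = b" using neg by (simp add: r_def)
      ultimately show False by simp
    qed
    have aK: "a \<in> K"
    proof -
      have "0 \<le> s \<bullet> a" if "s \<in> A" for s
      proof -
        have "s \<in> dual_cone K" using that by (auto simp: dual_cone_def K)
        from aD[OF this] show ?thesis by (simp only: inner_commute)
      qed
      then show ?thesis by (simp add: K)
    qed
    have aJ: "\<alpha> * a $ e < b" if "e \<in> J" for e
    proof -
      have "\<alpha> *\<^sub>R axis e 1 \<in> U"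
        using that pos by (auto simp: U_def inner_axis) (auto simp: axis_def)
      from aq[OF this zeroD] show ?thesis by (simp add: inner_axis)
    qed
    \<comment> \<open>The strict gap between the bound \<open>b\<close> and \<open>c \<bullet> a\<close> survives scaling \<open>a\<close> so that its entries
      on \<open>J\<close> are at most 1; this covers the case that they all vanish.\<close>
    define x where "x = (\<alpha> / b) *\<^sub>R a"
    have "x \<in> K" using aK pos b0 by (simp add: K x_def)
    moreover have "\<forall>e\<in>J. x $ e \<le> 1" using aJ b0 by (auto simp: x_def divide_simps less_imp_le)
    ultimately have "c \<bullet> x \<le> \<alpha>" by (rule bound)
    moreover have "\<alpha> < c \<bullet> x"
      using mult_strict_left_mono[OF ac pos] b0 by (simp add: x_def field_simps)
    ultimately show False by simp
  qed
  then obtain u s where us: "u \<in> U" "s \<in> dual_cone K" "c = u - s"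
    by (auto simp: Q_def)
  have "u \<in> dual_feasible K c"
    using us by (simp add: dual_feasible_def nonneg_orthant_def U_def)
  moreover have "supp u \<subseteq> J" using us(1) by (force simp: supp_def U_def)
  ultimately show ?thesis using us(1) by (auto simp: U_def)
qed

lemma weak_duality:
  fixes K :: "(real ^ 'e) set"
  assumes "v \<in> dual_feasible K c" "x \<in> unit_box_part K"
  shows "c \<bullet> x \<le> 1 \<bullet> v"
proof -
  have "0 \<le> (v - c) \<bullet> x"
    using assms by (auto simp: dual_feasible_def dual_cone_def unit_box_part_def)
  then have "c \<bullet> x \<le> v \<bullet> x" by (simp add: inner_diff_left)
  also have "\<dots> \<le> 1 \<bullet> v"
    using assms unfolding inner_vec_def
    by (intro sum_mono) (auto simp: dual_feasible_def nonneg_orthant_def unit_box_part_def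
        mem_box_cart mult_left_le)
  finally show ?thesis .
qed

lemma max_value_attained:
  fixes P :: "(real ^ 'e) set"
  assumes "compact P" "P \<noteq> {}"
  obtains x where "x \<in> P" "c \<bullet> x = max_value P c" "\<And>y. y \<in> P \<Longrightarrow> c \<bullet> y \<le> max_value P c"
proof -
  obtain x where x: "x \<in> P" "\<And>y. y \<in> P \<Longrightarrow> c \<bullet> y \<le> c \<bullet> x"
    using continuous_attains_sup[OF assms, of "\<lambda>x. c \<bullet> x"]
      continuous_on_inner[OF continuous_on_const continuous_on_id, of P c] by auto
  have "max_value P c = c \<bullet> x"
    unfolding max_value_def using x by (intro Greatest_equality) auto
  then show ?thesis using that[of x] x by simp
qed

section \<open>From dual supports to the families, and back\<close>

lemma B_fam_if_dual_support:
  fixes K :: "(real ^ 'e) set"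
  assumes "1 \<le> l" and u: "u \<in> dual_feasible K c" "1 \<bullet> u \<le> max_value P c" "supp u \<subseteq> J"
    and P: "P = unit_box_part K"
  shows "J \<in> B_fam P c l"
  unfolding B_fam_def mem_Collect_eq
proof (intro allI impI)
  fix z :: "nat \<Rightarrow> real ^ 'e"
  assume z: "\<forall>i\<in>{1..l}. z i \<in> P" and disj: "(\<Inter>i\<in>{1..l}. supp (z i)) \<inter> J = {}"
  have z01: "0 \<le> z i $ e" "z i $ e \<le> 1" if "i \<in> {1..l}" for i e
    using z that by (auto simp: P unit_box_part_def mem_box_cart)
  have u0: "0 \<le> u $ e" for e
    using u by (simp add: dual_feasible_def nonneg_orthant_def)
  have le: "(\<Sum>i=1..l. z i $ e) \<le> real l - 1" if "e \<in> J" for e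
  proof -
    have "e \<notin> (\<Inter>i\<in>{1..l}. supp (z i))" using disj that by blast
    then obtain j where j: "j \<in> {1..l}" "e \<notin> supp (z j)" by auto
    have "z j $ e \<le> 0" using j by (simp add: supp_def)
    moreover have "(\<Sum>i\<in>{1..l} - {j}. z i $ e) \<le> (\<Sum>i\<in>{1..l} - {j}. 1)"
      using z01 by (intro sum_mono) auto
    moreover have "(\<Sum>i\<in>{1..l} - {j}. 1) = real l - 1"
      using j(1) \<open>1 \<le> l\<close> by (simp add: of_nat_diff)
    ultimately show ?thesis using j(1) by (simp add: sum.remove)
  qed
  have "(\<Sum>i=1..l. c \<bullet> z i) \<le> (\<Sum>i=1..l. u \<bullet> z i)"
  proof (rule sum_mono)
    fix i assume "i \<in> {1..l}"
    then have "0 \<le> (u - c) \<bullet> z i"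
      using z u by (auto simp: P dual_feasible_def dual_cone_def unit_box_part_def)
    then show "c \<bullet> z i \<le> u \<bullet> z i" by (simp add: inner_diff_left)
  qed
  also have "\<dots> = (\<Sum>e\<in>UNIV. u $ e * (\<Sum>i=1..l. z i $ e))"
    unfolding inner_vec_def by (subst sum.swap) (simp add: sum_distrib_left)
  also have "\<dots> \<le> (\<Sum>e\<in>UNIV. u $ e * (real l - 1))"
  proof (rule sum_mono)
    fix e
    show "u $ e * (\<Sum>i=1..l. z i $ e) \<le> u $ e * (real l - 1)"
    proof (cases "e \<in> J")
      case True
      then show ?thesis using le u0 by (intro mult_left_mono) auto
    next
      case False
      then have "u $ e = 0" using u(3) u0[of e] by (force simp: supp_def)
      then show ?thesis by simp
    qed
  qed
  also have "\<dots> = (1 \<bullet> u) * (real l - 1)"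
    by (simp add: inner_vec_def sum_distrib_right)
  also have "\<dots> \<le> max_value P c * (real l - 1)"
    using u(2) \<open>1 \<le> l\<close> by (intro mult_right_mono) auto
  finally show "(\<Sum>i=1..l. c \<bullet> z i) \<le> max_value P c * (real l - 1)" .
qed

text \<open>Padding a pair with \<open>l - 2\<close> maximisers adds the same amount to both sides of the bound.\<close>

lemma B_fam_pair:
  fixes P :: "(real ^ 'e) set"
  assumes J: "J \<in> B_fam P c l" and "2 \<le> l"
    and m: "m \<in> P" "c \<bullet> m = max_value P c"
    and xy: "x \<in> P" "y \<in> P" "supp x \<inter> supp y \<inter> J = {}"
  shows "c \<bullet> x + c \<bullet> y \<le> max_value P c"
proof -
  define z where "z = (\<lambda>i::nat. if i = 1 then x else if i = 2 then y else m)"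
  have l: "{1..l} = insert 1 (insert 2 {3..l})" using \<open>2 \<le> l\<close> by auto
  have "\<forall>i\<in>{1..l}. z i \<in> P" using m xy by (auto simp: z_def)
  moreover have "(\<Inter>i\<in>{1..l}. supp (z i)) \<inter> J = {}"
    using xy(3) unfolding l by (auto simp: z_def)
  ultimately have "(\<Sum>i=1..l. c \<bullet> z i) \<le> max_value P c * (real l - 1)"
    using J unfolding B_fam_def by blast
  moreover have "(\<Sum>i=1..l. c \<bullet> z i) = c \<bullet> x + c \<bullet> y + (\<Sum>i=3..l. c \<bullet> z i)"
    unfolding l by (simp add: z_def)
  moreover have "(\<Sum>i=3..l. c \<bullet> z i) = (\<Sum>i=3..l. max_value P c)"
    by (intro sum.cong) (auto simp: z_def m)
  moreover have "\<dots> = (real l - 2) * max_value P c"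
    using \<open>2 \<le> l\<close> by (simp add: of_nat_diff)
  ultimately show ?thesis by (simp add: algebra_simps)
qed

text \<open>
  By integrality it suffices to bound \<open>c\<close> at integer points, and these split into pairs of integer
  points of \<open>P\<close>. Two nonnegative integers with sum at most 1 are not both positive.
\<close>

lemma relaxation_to_two:
  fixes K :: "(real ^ 'e) set"
  assumes cone: "\<And>x r. x \<in> K \<Longrightarrow> 0 \<le> r \<Longrightarrow> r *\<^sub>R x \<in> K"
    and box: "upper_box_integer K"
    and P: "P = unit_box_part K" and idp: "integer_decomposition P"
    and pair: "\<And>y z. y \<in> P \<Longrightarrow> z \<in> P \<Longrightarrow> supp y \<inter> supp z \<inter> J = {} \<Longrightarrow> c \<bullet> y + c \<bullet> z \<le> \<alpha>"
    and x: "x \<in> K" "x \<in> cbox 0 (\<chi> e. if e \<in> J then 1 else 2)"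
  shows "c \<bullet> x \<le> \<alpha>"
proof -
  define b :: "real ^ 'e" where "b = (\<chi> e. if e \<in> J then 1 else 2)"
  have "b \<in> integer_points \<inter> nonneg_orthant"
    by (auto simp: b_def integer_points_def nonneg_orthant_def)
  with box have hull: "K \<inter> cbox 0 b = convex hull (K \<inter> cbox 0 b \<inter> integer_points)"
    by (auto simp: upper_box_integer_def integral_polytope_def)
  have int: "c \<bullet> y \<le> \<alpha>" if y: "y \<in> K" "y \<in> cbox 0 b" "y \<in> integer_points" for y
  proof -
    have "(1/2) *\<^sub>R y \<in> P"
      using cone[OF y(1), of "1/2"] y(2)
      by (auto simp: P unit_box_part_def mem_box_cart b_def split: if_splits)
         (smt (verit))+
    moreover have "y = real 2 *\<^sub>R ((1/2) *\<^sub>R y)" by simp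
    ultimately have "y \<in> (\<lambda>p. real 2 *\<^sub>R p) ` P \<inter> integer_points"
      using y(3) by blast
    then obtain w where w: "\<forall>i\<in>{1..2::nat}. w i \<in> P \<inter> integer_points" "y = (\<Sum>i=1..2. w i)"
      using idp unfolding integer_decomposition_def by (metis one_le_numeral)
    have w12: "w 1 \<in> P" "w 2 \<in> P" "w 1 \<in> integer_points" "w 2 \<in> integer_points"
      using w(1) by auto
    have ysum: "y = w 1 + w 2" using w(2) by (simp add: numeral_2_eq_2)
    have "supp (w 1) \<inter> supp (w 2) \<inter> J = {}"
    proof (rule ccontr)
      assume "supp (w 1) \<inter> supp (w 2) \<inter> J \<noteq> {}"
      then obtain e where e: "0 < w 1 $ e" "0 < w 2 $ e" "e \<in> J"
        by (auto simp: supp_def)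
      have "1 \<le> w 1 $ e" "1 \<le> w 2 $ e"
        using w12(3,4) e(1,2) by (auto simp: integer_points_def elim!: Ints_cases dest!: spec[of _ e])
      moreover have "w 1 $ e + w 2 $ e \<le> 1"
        using y(2) e(3) unfolding mem_box_cart b_def ysum by (auto dest!: spec[of _ e])
      ultimately show False by simp
    qed
    from pair[OF w12(1,2) this] show ?thesis by (simp add: ysum inner_add_right)
  qed
  have "convex hull (K \<inter> cbox 0 b \<inter> integer_points) \<subseteq> {y. c \<bullet> y \<le> \<alpha>}"
    using int by (intro hull_minimal) (auto intro: convex_halfspace_le)
  with hull x show ?thesis by (auto simp: b_def)
qed

text \<open>
  A short enough step from a maximiser \<open>m\<close> over \<open>P\<close> towards \<open>x\<close> stays below 2 everywhere and keeps
  the bound 1 on \<open>J\<close>; as the objective is affine along the segment and does not exceed its value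
  at \<open>m\<close> after this step, it does not exceed it at \<open>x\<close>.
\<close>

lemma relaxation_unbounded:
  fixes K :: "(real ^ 'e) set"
  assumes K: "convex K" "K \<subseteq> nonneg_orthant"
    and m: "m \<in> unit_box_part K" "c \<bullet> m = \<alpha>"
    and two: "\<And>x. x \<in> K \<Longrightarrow> x \<in> cbox 0 (\<chi> e. if e \<in> J then 1 else 2) \<Longrightarrow> c \<bullet> x \<le> \<alpha>"
    and x: "x \<in> K" "\<forall>e\<in>J. x $ e \<le> 1"
  shows "c \<bullet> x \<le> \<alpha>"
proof -
  define t where "t = 1 / (1 + norm x)"
  have t: "0 < t" "t \<le> 1" "t * norm x \<le> 1"
    by (auto simp: t_def divide_simps add_pos_nonneg)
  define y where "y = (1 - t) *\<^sub>R m + t *\<^sub>R x"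
  have mK: "m \<in> K" and m01: "\<And>e. 0 \<le> m $ e" "\<And>e. m $ e \<le> 1"
    using m by (auto simp: unit_box_part_def mem_box_cart)
  have yK: "y \<in> K"
    unfolding y_def using K(1) mK x(1) t by (intro convexD) auto
  have "y $ e \<le> 1" if "e \<in> J" for e
    using m01[of e] x(2) that t by (auto simp: y_def intro!: convex_bound_le)
  moreover have "y $ e \<le> 2" for e
  proof -
    have "t * x $ e \<le> t * norm x"
      using t component_le_norm_cart[of x e] by (intro mult_left_mono) auto
    moreover have "(1 - t) * m $ e \<le> 1 * 1"
      using m01[of e] t by (intro mult_mono) auto
    ultimately show ?thesis using t(3) by (simp add: y_def)
  qed
  moreover have "0 \<le> y $ e" for e using yK K(2) by (auto simp: nonneg_orthant_def)
  ultimately have "c \<bullet> y \<le> \<alpha>" using yK by (intro two) (auto simp: mem_box_cart)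
  then have "t * (c \<bullet> x) \<le> t * \<alpha>"
    using m(2) by (simp add: y_def inner_add_right algebra_simps)
  then show ?thesis using t(1) by simp
qed

lemma minimal_members_upward_closure:
  "minimal_members {J. \<exists>S\<in>F. S \<subseteq> J} = minimal_members F"
    (is "?L = ?R")
proof (intro equalityI subsetI)
  fix J assume J: "J \<in> ?L"
  have min: "T = J" if "T \<in> F" "T \<subseteq> J" for T
    using J that by (auto simp: minimal_members_def)
  have "J \<in> F" using J min by (auto simp: minimal_members_def)
  with min show "J \<in> ?R" by (auto simp: minimal_members_def)
next
  fix J assume "J \<in> ?R"
  then have "J \<in> F" and min: "\<And>T. T \<in> F \<Longrightarrow> T \<subseteq> J \<Longrightarrow> T = J"
    by (auto simp: minimal_members_def)
  have "J' = J" if "T \<in> F" "T \<subseteq> J'" "J' \<subseteq> J" for J' T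
    using min[OF that(1)] that by auto
  with \<open>J \<in> F\<close> show "J \<in> ?L" by (auto simp: minimal_members_def)
qed

section \<open>The characterisation\<close>

theorem theorem4p2:
  fixes K P :: "(real ^ 'e) set" and c :: "real ^ 'e"
  assumes "2 \<le> CARD('e)"
    and "K \<subseteq> nonneg_orthant"
    and "rational_polyhedral_cone K"
    and "upper_box_integer K"
    and "P = unit_box_part K"
    and "integer_decomposition P"
    and "c \<in> rational_vectors"
    and "0 < max_value P c"
  shows "(\<forall>l\<ge>2. \<forall>J :: 'e set.
            J \<in> B_fam P c l \<longleftrightarrow> (\<exists>u \<in> dual_optimal K c. supp u \<subseteq> J))
       \<and> (\<forall>l\<ge>2. B_fam P c l = B_inf P c)
       \<and> (\<forall>l\<ge>2. D_fam P c l = D_inf P c)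
       \<and> D_fam P c 2 = minimal_members (supp ` dual_optimal K c)"
proof -
  obtain A where K: "K = {x. \<forall>a\<in>A. 0 \<le> a \<bullet> x}"
    using assms(3) by (auto simp: rational_polyhedral_cone_def)
  have cone: "r *\<^sub>R x \<in> K" if "x \<in> K" "0 \<le> r" for x r
    using that by (simp add: K)
  have KI: "K = (\<Inter>a\<in>A. {x. 0 \<le> a \<bullet> x})" by (auto simp: K)
  have conv: "convex K"
    unfolding KI by (intro convex_INT) (use convex_halfspace_ge in auto)
  have "closed K"
    unfolding KI by (auto intro!: closed_INT closed_Collect_le continuous_intros)
  then have comp: "compact P"
    unfolding assms(5) unit_box_part_def by (intro closed_Int_compact compact_cbox)
  have "0 \<in> P" by (simp add: assms(5) unit_box_part_def K mem_box_cart)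
  then obtain m where m: "m \<in> P" "c \<bullet> m = max_value P c"
      and le: "\<And>y. y \<in> P \<Longrightarrow> c \<bullet> y \<le> max_value P c"
    using max_value_attained[OF comp] by (metis empty_iff)
  have weak: "max_value P c \<le> 1 \<bullet> v" if "v \<in> dual_feasible K c" for v
    using weak_duality[OF that] m assms(5) by metis
  have optI: "u \<in> dual_optimal K c" if "u \<in> dual_feasible K c" "1 \<bullet> u \<le> max_value P c" for u
    using that weak by (force simp: dual_optimal_def)
  \<comment> \<open>Strong duality for the original problem is the case where all upper bounds are kept.\<close>
  have "c \<bullet> x \<le> max_value P c" if "x \<in> K" "\<forall>e\<in>UNIV. x $ e \<le> 1" for x
    using that assms(2) le
    by (auto simp: assms(5) unit_box_part_def mem_box_cart nonneg_orthant_def)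
  from dual_feasible_supported_on[OF K assms(8) this]
  obtain u0 where u0: "u0 \<in> dual_feasible K c" "1 \<bullet> u0 \<le> max_value P c" by auto
  have optD: "u \<in> dual_feasible K c" "1 \<bullet> u \<le> max_value P c" if "u \<in> dual_optimal K c" for u
    using that u0 by (force simp: dual_optimal_def)+
  have sound: "J \<in> B_fam P c l" if "u \<in> dual_optimal K c" "supp u \<subseteq> J" "1 \<le> l" for u J l
    using B_fam_if_dual_support[OF that(3) optD[OF that(1)] that(2) assms(5)] .
  have complete: "\<exists>u\<in>dual_optimal K c. supp u \<subseteq> J" if J: "J \<in> B_fam P c l" "2 \<le> l" for J l
  proof -
    have two: "c \<bullet> x \<le> max_value P c"
      if "x \<in> K" "x \<in> cbox 0 (\<chi> e. if e \<in> J then 1 else 2)" for x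
      using relaxation_to_two[OF cone assms(4-6) B_fam_pair[OF J m] that] by blast
    have "c \<bullet> x \<le> max_value P c" if "x \<in> K" "\<forall>e\<in>J. x $ e \<le> 1" for x
      using relaxation_unbounded[OF conv assms(2) _ m(2) two that] m(1) assms(5) by blast
    from dual_feasible_supported_on[OF K assms(8) this] show ?thesis
      using optI by blast
  qed
  have iff: "J \<in> B_fam P c l \<longleftrightarrow> (\<exists>u\<in>dual_optimal K c. supp u \<subseteq> J)" if "2 \<le> l" for J l
    using complete[of J l] sound[of _ J l] that by auto
  have Binf: "B_fam P c l = B_inf P c" if "2 \<le> l" for l
  proof
    show "B_fam P c l \<subseteq> B_inf P c"
      using complete[OF _ that] sound unfolding B_inf_def by fastforce
    show "B_inf P c \<subseteq> B_fam P c l"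
      using that unfolding B_inf_def by auto
  qed
  have "B_fam P c 2 = {J. \<exists>S\<in>supp ` dual_optimal K c. S \<subseteq> J}"
    using iff[of 2] by auto
  then have "D_fam P c 2 = minimal_members (supp ` dual_optimal K c)"
    unfolding D_fam_def by (simp only: minimal_members_upward_closure)
  with iff Binf show ?thesis by (auto simp: D_fam_def D_inf_def)
qed

end
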